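(* Consider a general inventory system with $n$ items, whose bill-of-materials network has adjacency matrix $A\in\mathbb{R}^{n\times n}$, $m$ arcs and density $\rho = \frac{m}{n(n-1)}$. Let the IPA algorithm be the forward (infinitesimal perturbation analysis) procedure described in the context, which computes the sample-path gradient $\frac{\partial C_T^{sum}}{\partial S}$ of the total cost with respect to the base-stock levels $S\in\mathbb{R}^n$. Then: (i) the computational complexity of the IPA algorithm for a simulation with $T$ periods is $O(Tn^3)$; (ii) if sparse matrix techniques are used to handle the adjacency matrix $A$, the computational complexity is $O(T\rho n^3)$; (iii) if, furthermore, $n\rho\sim\text{constant}$ (i.e. the average in-degree $m/n=(n-1)\rho\approx n\rho$ is a constant that does not grow with $n$), the computational complexity may be reduced to $O(Tn^2)$.
   Context: **Network.** There are $n$ items, divided into raw material items (procured from outside) and production items (sub-assemblies and final products). The bill of materials (BOM) is an acyclic directed network on the items. Its adjacency matrix $A=(a_{ij})$ has $a_{ij}>0$ if $a_{ij}$ units of item $i$ are required to produce one unit of the (immediate downstream) item $j$ (an arc $i\to j$ of weight $a_{ij}$), and $a_{ij}=0$ otherwise. Every raw material item is a component of some downstream item, and every production item has at least one upstream component. $m$ is the number of arcs, and $\rho=m/(n(n-1))$. The number of layers is $n_l=\sup\{r\in\mathbb{N}: (A^r)_{ij}>0 \text{ for some } i,j\}+1$; it is treated as a constant (bounded independently of $n$ and $T$). **Data.** Given are: row vectors $S$ (base-stock levels), $h$ (unit holding costs), $p$ (unit stockout penalties), $I^{initial}$ (initial on-hand inventory), all in $\mathbb{R}^n$; outside demand vectors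 $D_t^{out}\in\mathbb{R}^n$; and integer lead times $l_{t,i}$. All other simulation quantities with a single time index $t$ are row vectors in $\mathbb{R}^n$, except the scalars $C_t$, $C_t^{sum}$; a second index $i$ denotes the $i$-th component. $\min$, $\max$ and division of vectors are element-wise. **Simulation** (its values are available to the gradient procedure). Initialize $IP_0=I_0=I^{initial}$, $O_0=0$, $D_0^{out}=0$, $B_0^{out}=0$, $O_0^b=0$, $C_0^{sum}=0$. For $t=1,\dots,T$: $IP_t\leftarrow IP_{t-1}+O_{t-1}-O_{t-1}A^T-D_{t-1}^{out}$; $O_t\leftarrow-\min\{0,IP_t-D_t^{out}-S\}$; for $l=1,\dots,n_l-1$: $IP_t^{temp}\leftarrow IP_t-D_t^{out}-O_tA^T$ and $O_t\leftarrow-\min\{0,IP_t^{temp}-S\}$; $I_t^{temp}= I_{t-1}+P_t-B_{t-1}^{out}-D_t^{out}$; $I_t^0\leftarrow\max\{0,I_t^{temp}\}$; $B_t^{out}\leftarrow-\min\{0,I_t^{temp}\}$; for each raw material item $i$: $P_{t+l_{t,i},i}\leftarrow O_{t,i}$; $I_t^{need}=(O_t+O_{t-1}^b)A^T$; $r_t\leftarrow\min\{I_t^0/I_t^{need},1\}$; for each production item $i$: $k_{t,i}=\min_{j:\,a_{ji}\ne0}\{r_{t,j}\}$, $M_{t,i}\leftarrow k_{t,i}(O_{t,i}+O_{t-1,i}^b)$, $P_{t+l_{t,i},i}\leftarrow M_{t,i}$; $O_t^b\leftarrow O_t+O_{t-1}^b-M_t$; $I_t\leftarrow I_t^0-M_tA^T$;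 $C_t\leftarrow I_th^T+B_t^{out}p^T$; $C_t^{sum}\leftarrow C_{t-1}^{sum}+C_t$. **IPA algorithm.** For a vector quantity $X$, $\frac{\partial X}{\partial S}$ denotes the $n\times n$ Jacobian matrix whose $i$-th row is the $1\times n$ vector $\frac{\partial X_i}{\partial S}$; for a scalar it is a $1\times n$ vector. $E$ is the $n\times n$ identity matrix, $1_{\{\cdot\}}$ is the (element-wise) indicator, and $diag(v)$ is the diagonal matrix with diagonal $v$. Initialize $\frac{\partial IP_0}{\partial S}=\frac{\partial I_0}{\partial S}=0$, $\frac{\partial O_0}{\partial S}=0$, $\frac{\partial B_0^{out}}{\partial S}=0$, $\frac{\partial O_0^b}{\partial S}=0$, $\frac{\partial C_0^{sum}}{\partial S}=0$. For $t=1,\dots,T$ do: 1. $\frac{\partial IP_t}{\partial S}\leftarrow\frac{\partial IP_{t-1}}{\partial S}+\frac{\partial O_{t-1}}{\partial S}-A\frac{\partial O_{t-1}}{\partial S}$; 2. $\frac{\partial O_t}{\partial S}\leftarrow diag(-1_{\{IP_t-D_t^{out}-S<0\}})\left(\frac{\partial IP_t}{\partial S}-E\right)$; 3. for $k=1,\dots,n_l-1$: $\frac{\partial IP_t^{temp}}{\partial S}\leftarrow\frac{\partial IP_t}{\partial S}-A\frac{\partial O_t}{\partial S}$, then $\frac{\partial O_t}{\partial S}\leftarrow diag(-1_{\{IP_t^{temp}-S<0\}})\left(\frac{\partial IP_t^{temp}}{\partial S}-E\right)$; 4. $\frac{\partial I_t^{temp}}{\partial S}\leftarrow\frac{\partial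 I_{t-1}}{\partial S}+\frac{\partial P_t}{\partial S}-\frac{\partial B_{t-1}^{out}}{\partial S}$; 5. $\frac{\partial I_t^0}{\partial S}\leftarrow diag(1_{\{I_t^{temp}>0\}})\frac{\partial I_t^{temp}}{\partial S}$; $\frac{\partial B_t^{out}}{\partial S}\leftarrow diag(-1_{\{I_t^{temp}\le0\}})\frac{\partial I_t^{temp}}{\partial S}$; 6. for each raw material item $i$: $\frac{\partial P_{t+l_{t,i},i}}{\partial S}\leftarrow\frac{\partial O_{t,i}}{\partial S}$; 7. $\frac{\partial I_t^{need}}{\partial S}\leftarrow A\left(\frac{\partial O_t}{\partial S}+\frac{\partial O_{t-1}^b}{\partial S}\right)$; 8. $\frac{\partial r_t}{\partial S}\leftarrow diag(1_{\{I_t^0/I_t^{need}<1\}})\,diag(1/I_t^{need})\left(\frac{\partial I_t^0}{\partial S}-diag(I_t^0/I_t^{need})\frac{\partial I_t^{need}}{\partial S}\right)$; 9. for each production item $i$: $\frac{\partial k_{t,i}}{\partial S}\leftarrow\left(1_{\{r_{t,j}=k_{t,i},\,a_{ji}\ne0\}}\right)_{j=1,\dots,n}\frac{\partial r_t}{\partial S}$; $\frac{\partial M_{t,i}}{\partial S}\leftarrow(O_{t,i}+O_{t-1,i}^b)\frac{\partial k_{t,i}}{\partial S}+k_{t,i}\left(\frac{\partial O_{t,i}}{\partial S}+\frac{\partial O_{t-1,i}^b}{\partial S}\right)$; $\frac{\partial P_{t+l_{t,i},i}}{\partial S}\leftarrow\frac{\partial M_{t,i}}{\partial S}$; 10. $\frac{\partial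 I_t}{\partial S}\leftarrow\frac{\partial I_t^0}{\partial S}-A\frac{\partial M_t}{\partial S}$; 11. $\frac{\partial O_t^b}{\partial S}\leftarrow\frac{\partial O_t}{\partial S}+\frac{\partial O_{t-1}^b}{\partial S}-\frac{\partial M_t}{\partial S}$; 12. $\frac{\partial C_t}{\partial S}\leftarrow h\frac{\partial I_t}{\partial S}+p\frac{\partial B_t^{out}}{\partial S}$; $\frac{\partial C_t^{sum}}{\partial S}\leftarrow\frac{\partial C_{t-1}^{sum}}{\partial S}+\frac{\partial C_t}{\partial S}$. **Cost model.** Computational complexity counts elementary scalar operations (additions, multiplications, divisions, comparisons, assignments), each of cost $O(1)$. Addition of two $n\times n$ matrices costs $O(n^2)$; multiplication of two dense $n\times n$ matrices costs $O(n^3)$ (standard multiplication); multiplying an $n\times n$ matrix by a diagonal matrix costs $O(n^2)$. Using sparse matrix techniques for $A$ means that only the nonzero entries of $A$ are stored and processed, so the product of $A$ with a dense $n\times n$ matrix costs $O(\rho n^3)$, and operations indexed by $\{j:a_{ji}\ne0\}$ involve only the nonzero entries of column $i$. The Jacobian matrices are treated as dense. Complexities are asymptotic in $n$ and $T$. *)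

theory Defs
  imports
    Complex_Main
    "HOL-Library.Monad_Syntax"
    "HOL-Library.Landau_Symbols"
    "Jordan_Normal_Form.Matrix"
begin

section \<open>Inventory systems\<close>

text \<open>
  Items are \<open>0, \<dots>, n - 1\<close>, periods are \<open>1, \<dots>, T\<close>.  Vectors and matrices have an
  explicit dimension because the complexity bounds are uniform in \<open>n\<close>.
  The row vector \<open>v A\<^sup>T\<close> is written \<open>A *\<^sub>v v\<close>.
\<close>

record inventory =
  items :: nat
  periods :: nat
  bom :: "real mat"
  raw :: "nat set"
  base_stock :: "real vec"
  holding :: "real vec"
  penalty :: "real vec"
  initial_stock :: "real vec"
  demand :: "nat \<Rightarrow> real vec"
  lead_time :: "nat \<Rightarrow> nat \<Rightarrow> nat"

definition arcs :: "inventory \<Rightarrow> (nat \<times> nat) set" where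
  "arcs x = {(i, j). i < items x \<and> j < items x \<and> bom x $$ (i, j) > 0}"

definition density :: "inventory \<Rightarrow> real" where
  "density x = real (card (arcs x)) / (real (items x) * (real (items x) - 1))"

definition layers :: "inventory \<Rightarrow> nat" where
  "layers x = Sup {r. \<exists>i < items x. \<exists>j < items x. (bom x ^\<^sub>m r) $$ (i, j) > 0} + 1"

definition inventory_system :: "inventory \<Rightarrow> bool" where
  "inventory_system x \<longleftrightarrow>
     0 < items x \<and> 0 < periods x \<and>
     bom x \<in> carrier_mat (items x) (items x) \<and>
     (\<forall>i < items x. \<forall>j < items x. 0 \<le> bom x $$ (i, j)) \<and>
     acyclic (arcs x) \<and>
     raw x \<subseteq> {..<items x} \<and>
     (\<forall>i \<in> raw x. \<exists>j. (i, j) \<in> arcs x) \<and>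
     (\<forall>i \<in> {..<items x} - raw x. \<exists>j. (j, i) \<in> arcs x) \<and>
     base_stock x \<in> carrier_vec (items x) \<and>
     holding x \<in> carrier_vec (items x) \<and>
     penalty x \<in> carrier_vec (items x) \<and>
     initial_stock x \<in> carrier_vec (items x) \<and>
     (\<forall>t. demand x t \<in> carrier_vec (items x))"

text \<open>
  A complexity bound \<open>O(g)\<close> is \<open>O[principal (systems L)](g)\<close>: one constant, depending only
  on the bound \<open>L\<close> for the number of layers, works for every \<open>n\<close>, every \<open>T\<close> and all data.
\<close>

definition systems :: "nat \<Rightarrow> inventory set" where
  "systems L = {x. inventory_system x \<and> layers x \<le> L}"


section \<open>Simulation\<close>

text \<open>
  The fields hold the values of the current period; \<open>ip_temp l\<close> is the value of
  \<open>IP\<^sup>t\<^sup>e\<^sup>m\<^sup>p\<close> in round \<open>l\<close> of the layer loop, and \<open>pipeline s\<close> is \<open>P\<^sub>s\<close>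
  as assigned so far.
\<close>

record sim_state =
  ip :: "real vec"
  ip_temp :: "nat \<Rightarrow> real vec"
  orders :: "real vec"
  i_temp :: "real vec"
  i_avail :: "real vec"
  backlog :: "real vec"
  i_need :: "real vec"
  ratio :: "real vec"
  kit :: "real vec"
  made :: "real vec"
  open_orders :: "real vec"
  on_hand :: "real vec"
  pipeline :: "nat \<Rightarrow> real vec"
  cost :: real
  total_cost :: real

definition out_demand :: "inventory \<Rightarrow> nat \<Rightarrow> real vec" where
  "out_demand x t = (if t = 0 then 0\<^sub>v (items x) else demand x t)"

definition pos_part :: "real vec \<Rightarrow> real vec" where
  "pos_part v = map_vec (\<lambda>a. max 0 a) v"

definition neg_part :: "real vec \<Rightarrow> real vec" where
  "neg_part v = map_vec (\<lambda>a. - min 0 a) v"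

primrec layer_orders :: "inventory \<Rightarrow> nat \<Rightarrow> real vec \<Rightarrow> nat \<Rightarrow> real vec" where
  "layer_orders x t IP 0 = neg_part (IP - out_demand x t - base_stock x)"
| "layer_orders x t IP (Suc l) =
     neg_part (IP - out_demand x t - bom x *\<^sub>v layer_orders x t IP l - base_stock x)"

definition sim_init :: "inventory \<Rightarrow> sim_state" where
  "sim_init x =
    (let z = 0\<^sub>v (items x) in
     \<lparr> ip = initial_stock x, ip_temp = (\<lambda>_. z), orders = z, i_temp = z, i_avail = z,
       backlog = z, i_need = z, ratio = z, kit = z, made = z, open_orders = z,
       on_hand = initial_stock x, pipeline = (\<lambda>_. z), cost = 0, total_cost = 0 \<rparr>)"

text \<open>
  An item that nobody needs has \<open>I\<^sup>0 / I\<^sup>n\<^sup>e\<^sup>e\<^sup>d = \<infinity>\<close>, hence \<open>r = 1\<close>; the case distinction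
  is needed because \<open>a / 0 = 0\<close> for the type \<open>real\<close>.  Entries that are never assigned
  (deliveries that have not been scheduled, \<open>M\<close> and \<open>k\<close> of raw material items) are \<open>0\<close>.
\<close>

definition sim_step :: "inventory \<Rightarrow> nat \<Rightarrow> sim_state \<Rightarrow> sim_state" where
  "sim_step x t s =
    (let n = items x; A = bom x; D = out_demand x t;
         IP = ip s + orders s - A *\<^sub>v orders s - out_demand x (t - 1);
         IPtemp = (\<lambda>l. IP - D - A *\<^sub>v layer_orders x t IP (l - 1));
         Ord = layer_orders x t IP (layers x - 1);
         Itemp = on_hand s + pipeline s t - backlog s - D;
         I0 = pos_part Itemp;
         B = neg_part Itemp;
         Ineed = A *\<^sub>v (Ord + open_orders s);
         r = vec n (\<lambda>i. if Ineed $ i = 0 then 1 else min (I0 $ i / Ineed $ i) 1);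
         k = vec n (\<lambda>i. if i \<in> raw x then 0
                        else Min ((\<lambda>j. r $ j) ` {j. j < n \<and> A $$ (j, i) \<noteq> 0}));
         M = vec n (\<lambda>i. if i \<in> raw x then 0 else k $ i * (Ord $ i + open_orders s $ i));
         P = (\<lambda>u. vec n (\<lambda>i. if u = t + lead_time x t i
                               then (if i \<in> raw x then Ord $ i else M $ i)
                               else pipeline s u $ i));
         I = I0 - A *\<^sub>v M;
         C = I \<bullet> holding x + B \<bullet> penalty x
     in \<lparr> ip = IP, ip_temp = IPtemp, orders = Ord, i_temp = Itemp, i_avail = I0,
          backlog = B, i_need = Ineed, ratio = r, kit = k, made = M,
          open_orders = Ord + open_orders s - M, on_hand = I, pipeline = P,
          cost = C, total_cost = total_cost s + C \<rparr>)"

primrec sim :: "inventory \<Rightarrow> nat \<Rightarrow> sim_state" where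
  "sim x 0 = sim_init x"
| "sim x (Suc t) = sim_step x (Suc t) (sim x t)"


section \<open>Operation counting\<close>

text \<open>
  A value together with the number of elementary scalar operations spent on it.  Below,
  every \<^term>\<open>tick\<close> wraps exactly one scalar addition, subtraction, multiplication,
  division, comparison or assignment; anything outside \<^term>\<open>tick\<close> only reads stored
  scalars, branches on Booleans that have been paid for, or arranges computed scalars in a
  vector or matrix.
\<close>

datatype 'a counted = Counted (val: 'a) (ops: nat)

definition ret :: "'a \<Rightarrow> 'a counted" where
  "ret a = Counted a 0"

definition tick :: "'a \<Rightarrow> 'a counted" where
  "tick a = Counted a 1"

definition counted_bind :: "'a counted \<Rightarrow> ('a \<Rightarrow> 'b counted) \<Rightarrow> 'b counted" where
  "counted_bind m f = Counted (val (f (val m))) (ops m + ops (f (val m)))"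

adhoc_overloading Monad_Syntax.bind \<rightleftharpoons> counted_bind

lemma counted_simps [simp]:
  "val (ret a) = a" "ops (ret a) = 0"
  "val (tick a) = a" "ops (tick a) = 1"
  "val (counted_bind m f) = val (f (val m))"
  "ops (counted_bind m f) = ops m + ops (f (val m))"
  by (simp_all add: ret_def tick_def counted_bind_def)

text \<open>Each iteration of a loop also costs the assignment of the loop variable.\<close>

primrec map_loop :: "('a \<Rightarrow> 'b counted) \<Rightarrow> 'a list \<Rightarrow> 'b list counted" where
  "map_loop f [] = ret []"
| "map_loop f (a # as) = do { i \<leftarrow> tick a; b \<leftarrow> f i; bs \<leftarrow> map_loop f as; ret (b # bs) }"

primrec fold_loop :: "('a \<Rightarrow> 's \<Rightarrow> 's counted) \<Rightarrow> 'a list \<Rightarrow> 's \<Rightarrow> 's counted" where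
  "fold_loop f [] s = ret s"
| "fold_loop f (a # as) s = do { i \<leftarrow> tick a; s' \<leftarrow> f i s; fold_loop f as s' }"

definition sum_loop :: "('a \<Rightarrow> real counted) \<Rightarrow> 'a list \<Rightarrow> real counted" where
  "sum_loop f as = fold_loop (\<lambda>a s. do { b \<leftarrow> f a; tick (s + b) }) as 0"

definition build_vec :: "nat \<Rightarrow> (nat \<Rightarrow> real counted) \<Rightarrow> real vec counted" where
  "build_vec n f =
    do { as \<leftarrow> map_loop (\<lambda>i. do { a \<leftarrow> f i; tick a }) [0..<n]; ret (vec_of_list as) }"

definition build_mat :: "nat \<Rightarrow> (nat \<Rightarrow> nat \<Rightarrow> real counted) \<Rightarrow> real mat counted" where
  "build_mat n f =
    do { rows \<leftarrow> map_loop (\<lambda>i. map_loop (\<lambda>j. do { a \<leftarrow> f i j; tick a }) [0..<n]) [0..<n];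
         ret (mat_of_rows_list n rows) }"

definition zero_vec_op :: "nat \<Rightarrow> real vec counted" where
  "zero_vec_op n = build_vec n (\<lambda>i. ret 0)"

definition vec_add_op :: "nat \<Rightarrow> real vec \<Rightarrow> real vec \<Rightarrow> real vec counted" where
  "vec_add_op n u v = build_vec n (\<lambda>i. tick (u $ i + v $ i))"

definition vec_sub_op :: "nat \<Rightarrow> real vec \<Rightarrow> real vec \<Rightarrow> real vec counted" where
  "vec_sub_op n u v = build_vec n (\<lambda>i. tick (u $ i - v $ i))"

definition zero_mat_op :: "nat \<Rightarrow> real mat counted" where
  "zero_mat_op n = build_mat n (\<lambda>i j. ret 0)"

definition id_mat_op :: "nat \<Rightarrow> real mat counted" where
  "id_mat_op n = build_mat n (\<lambda>i j. do { b \<leftarrow> tick (i = j); ret (if b then 1 else 0) })"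

definition mat_add_op :: "nat \<Rightarrow> real mat \<Rightarrow> real mat \<Rightarrow> real mat counted" where
  "mat_add_op n X Y = build_mat n (\<lambda>i j. tick (X $$ (i, j) + Y $$ (i, j)))"

definition mat_sub_op :: "nat \<Rightarrow> real mat \<Rightarrow> real mat \<Rightarrow> real mat counted" where
  "mat_sub_op n X Y = build_mat n (\<lambda>i j. tick (X $$ (i, j) - Y $$ (i, j)))"

definition diag_mult_op :: "nat \<Rightarrow> real vec \<Rightarrow> real mat \<Rightarrow> real mat counted" where
  "diag_mult_op n v X = build_mat n (\<lambda>i j. tick (v $ i * X $$ (i, j)))"

definition vec_mat_op :: "nat \<Rightarrow> real vec \<Rightarrow> real mat \<Rightarrow> real vec counted" where
  "vec_mat_op n v X =
    build_vec n (\<lambda>j. sum_loop (\<lambda>i. tick (v $ i * X $$ (i, j))) [0..<n])"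

text \<open>In-place overwriting of row \<open>i\<close>: only its \<open>n\<close> entries are assigned.\<close>

definition write_row_op :: "nat \<Rightarrow> nat \<Rightarrow> real vec \<Rightarrow> real mat \<Rightarrow> real mat counted" where
  "write_row_op n i v X =
    do { w \<leftarrow> build_vec n (\<lambda>j. ret (v $ j));
         ret (mat n n (\<lambda>(r, c). if r = i then w $ c else X $$ (r, c))) }"

definition indicator_op :: "nat \<Rightarrow> (nat \<Rightarrow> bool counted) \<Rightarrow> real vec counted" where
  "indicator_op n P = build_vec n (\<lambda>i. do { b \<leftarrow> P i; ret (if b then 1 else 0) })"

definition neg_indicator_op :: "nat \<Rightarrow> (nat \<Rightarrow> bool counted) \<Rightarrow> real vec counted" where
  "neg_indicator_op n P = build_vec n (\<lambda>i. do { b \<leftarrow> P i; ret (if b then - 1 else 0) })"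


subsection \<open>Storage of the adjacency matrix\<close>

text \<open>
  The gradient procedure sees \<open>A\<close> only through its stored entries: row \<open>i\<close> as pairs
  \<open>(j, a\<^sub>i\<^sub>j)\<close> and column \<open>i\<close> as pairs \<open>(j, a\<^sub>j\<^sub>i)\<close>.  Dense storage keeps all entries,
  sparse storage only the nonzero ones.
\<close>

record adjacency =
  row_entries :: "nat \<Rightarrow> (nat \<times> real) list"
  col_entries :: "nat \<Rightarrow> (nat \<times> real) list"

definition dense :: "nat \<Rightarrow> real mat \<Rightarrow> adjacency" where
  "dense n A =
    \<lparr> row_entries = (\<lambda>i. map (\<lambda>j. (j, A $$ (i, j))) [0..<n]),
      col_entries = (\<lambda>i. map (\<lambda>j. (j, A $$ (j, i))) [0..<n]) \<rparr>"

definition sparse :: "nat \<Rightarrow> real mat \<Rightarrow> adjacency" where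
  "sparse n A =
    \<lparr> row_entries = (\<lambda>i. map (\<lambda>j. (j, A $$ (i, j))) (filter (\<lambda>j. A $$ (i, j) \<noteq> 0) [0..<n])),
      col_entries = (\<lambda>i. map (\<lambda>j. (j, A $$ (j, i))) (filter (\<lambda>j. A $$ (j, i) \<noteq> 0) [0..<n])) \<rparr>"

definition adj_mult_op :: "nat \<Rightarrow> adjacency \<Rightarrow> real mat \<Rightarrow> real mat counted" where
  "adj_mult_op n G X =
    build_mat n (\<lambda>i c. sum_loop (\<lambda>(j, a). tick (a * X $$ (j, c))) (row_entries G i))"

text \<open>The row vector with entries \<open>1\<close> where \<open>r\<^sub>j = k\<close> and \<open>a\<^sub>j\<^sub>i \<noteq> 0\<close>, times \<open>X\<close>.\<close>

definition argmin_row_op ::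
  "nat \<Rightarrow> adjacency \<Rightarrow> nat \<Rightarrow> real vec \<Rightarrow> real \<Rightarrow> real mat \<Rightarrow> real vec counted" where
  "argmin_row_op n G i r k X =
    do { w \<leftarrow> map_loop (\<lambda>(j, a). do { b \<leftarrow> tick (r $ j = k); c \<leftarrow> tick (a \<noteq> 0);
                                     u \<leftarrow> tick (if b \<and> c then 1 else 0); ret (j, u) })
                       (col_entries G i);
         build_vec n (\<lambda>c. sum_loop (\<lambda>(j, u). tick (u * X $$ (j, c))) w) }"


section \<open>The gradient procedure\<close>

text \<open>\<open>d_pipe s\<close> is the Jacobian of \<open>P\<^sub>s\<close>.\<close>

record jacobians =
  d_ip :: "real mat"
  d_orders :: "real mat"
  d_on_hand :: "real mat"
  d_backlog :: "real mat"
  d_open :: "real mat"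
  d_pipe :: "nat \<Rightarrow> real mat"
  d_total :: "real vec"

definition ipa_init :: "inventory \<Rightarrow> jacobians counted" where
  "ipa_init x =
    (let n = items x in
     do { dIP \<leftarrow> zero_mat_op n;
          dO \<leftarrow> zero_mat_op n;
          dI \<leftarrow> zero_mat_op n;
          dB \<leftarrow> zero_mat_op n;
          dOb \<leftarrow> zero_mat_op n;
          dP \<leftarrow> fold_loop (\<lambda>t P. do { Z \<leftarrow> zero_mat_op n; ret (P(t := Z)) })
                 [1..<Suc (periods x)] (\<lambda>_. 0\<^sub>m n n);
          dC \<leftarrow> zero_vec_op n;
          ret \<lparr> d_ip = dIP, d_orders = dO, d_on_hand = dI, d_backlog = dB, d_open = dOb,
                d_pipe = dP, d_total = dC \<rparr> })"

definition ipa_step :: "adjacency \<Rightarrow> inventory \<Rightarrow> nat \<Rightarrow> jacobians \<Rightarrow> jacobians counted" where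
  "ipa_step G x t J =
    (let n = items x; S = base_stock x; s = sim x t; s_prev = sim x (t - 1) in
     do {
       E \<leftarrow> id_mat_op n;

       X \<leftarrow> mat_add_op n (d_ip J) (d_orders J);
       Y \<leftarrow> adj_mult_op n G (d_orders J);
       dIP \<leftarrow> mat_sub_op n X Y;

       v \<leftarrow> vec_sub_op n (ip s) (out_demand x t);
       v \<leftarrow> vec_sub_op n v S;
       w \<leftarrow> neg_indicator_op n (\<lambda>i. tick (v $ i < 0));
       X \<leftarrow> mat_sub_op n dIP E;
       dO \<leftarrow> diag_mult_op n w X;

       dO \<leftarrow> fold_loop (\<lambda>l dO. do {
               Y \<leftarrow> adj_mult_op n G dO;
               dIPtemp \<leftarrow> mat_sub_op n dIP Y;
               v \<leftarrow> vec_sub_op n (ip_temp s l) S;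
               w \<leftarrow> neg_indicator_op n (\<lambda>i. tick (v $ i < 0));
               X \<leftarrow> mat_sub_op n dIPtemp E;
               diag_mult_op n w X }) [1..<layers x] dO;

       X \<leftarrow> mat_add_op n (d_on_hand J) (d_pipe J t);
       dItemp \<leftarrow> mat_sub_op n X (d_backlog J);

       w \<leftarrow> indicator_op n (\<lambda>i. tick (i_temp s $ i > 0));
       dI0 \<leftarrow> diag_mult_op n w dItemp;
       w \<leftarrow> neg_indicator_op n (\<lambda>i. tick (i_temp s $ i \<le> 0));
       dB \<leftarrow> diag_mult_op n w dItemp;

       dP \<leftarrow> fold_loop (\<lambda>i dP. do {
               b \<leftarrow> tick (i \<in> raw x);
               if b then do {
                 u \<leftarrow> tick (t + lead_time x t i);
                 R \<leftarrow> write_row_op n i (row dO i) (dP u);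
                 ret (dP(u := R)) }
               else ret dP }) [0..<n] (d_pipe J);

       dOsum \<leftarrow> mat_add_op n dO (d_open J);
       dIneed \<leftarrow> adj_mult_op n G dOsum;

       q \<leftarrow> build_vec n (\<lambda>i. tick (i_avail s $ i / i_need s $ i));
       Y \<leftarrow> diag_mult_op n q dIneed;
       X \<leftarrow> mat_sub_op n dI0 Y;
       v \<leftarrow> build_vec n (\<lambda>i. tick (1 / i_need s $ i));
       X \<leftarrow> diag_mult_op n v X;
       w \<leftarrow> indicator_op n (\<lambda>i. do { b \<leftarrow> tick (i_need s $ i \<noteq> 0); c \<leftarrow> tick (q $ i < 1);
                                     ret (b \<and> c) });
       dr \<leftarrow> diag_mult_op n w X;

       Z \<leftarrow> zero_mat_op n;
       (dM, dP) \<leftarrow> fold_loop (\<lambda>i (dM, dP). do {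
               b \<leftarrow> tick (i \<in> raw x);
               if b then ret (dM, dP)
               else do {
                 dk \<leftarrow> argmin_row_op n G i (ratio s) (kit s $ i) dr;
                 o_i \<leftarrow> tick (orders s $ i + open_orders s_prev $ i);
                 dM_i \<leftarrow> build_vec n (\<lambda>c. do {
                         a \<leftarrow> tick (o_i * dk $ c);
                         d \<leftarrow> tick (dO $$ (i, c) + d_open J $$ (i, c));
                         e \<leftarrow> tick (kit s $ i * d);
                         tick (a + e) });
                 dM \<leftarrow> write_row_op n i dM_i dM;
                 u \<leftarrow> tick (t + lead_time x t i);
                 R \<leftarrow> write_row_op n i dM_i (dP u);
                 ret (dM, dP(u := R)) } }) [0..<n] (Z, dP);

       Y \<leftarrow> adj_mult_op n G dM;
       dI \<leftarrow> mat_sub_op n dI0 Y;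

       dOb \<leftarrow> mat_sub_op n dOsum dM;

       v \<leftarrow> vec_mat_op n (holding x) dI;
       w \<leftarrow> vec_mat_op n (penalty x) dB;
       dC \<leftarrow> vec_add_op n v w;
       dCsum \<leftarrow> vec_add_op n (d_total J) dC;

       ret \<lparr> d_ip = dIP, d_orders = dO, d_on_hand = dI, d_backlog = dB, d_open = dOb,
             d_pipe = dP, d_total = dCsum \<rparr>
     })"

definition ipa :: "adjacency \<Rightarrow> inventory \<Rightarrow> real vec counted" where
  "ipa G x =
    do { J \<leftarrow> ipa_init x;
         J \<leftarrow> fold_loop (ipa_step G x) [1..<Suc (periods x)] J;
         ret (d_total J) }"

definition ipa_dense :: "inventory \<Rightarrow> real vec counted" where
  "ipa_dense x = ipa (dense (items x) (bom x)) x"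

definition ipa_sparse :: "inventory \<Rightarrow> real vec counted" where
  "ipa_sparse x = ipa (sparse (items x) (bom x)) x"


section \<open>The counted operations compute the intended matrices\<close>

lemma val_map_loop [simp]: "val (map_loop f as) = map (\<lambda>a. val (f a)) as"
  by (induction as) auto

lemma val_sum_loop [simp]: "val (sum_loop f as) = (\<Sum>a\<leftarrow>as. val (f a))"
proof -
  have "val (fold_loop (\<lambda>a s. do { b \<leftarrow> f a; tick (s + b) }) as s) = s + (\<Sum>a\<leftarrow>as. val (f a))" for s
    by (induction as arbitrary: s) (auto simp: algebra_simps)
  then show ?thesis by (simp add: sum_loop_def)
qed

lemma val_build_vec [simp]: "val (build_vec n f) = vec n (\<lambda>i. val (f i))"
  by (auto simp: build_vec_def vec_of_list_index)

lemma val_build_mat [simp]: "val (build_mat n f) = mat n n (\<lambda>(i, j). val (f i j))"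
  by (auto simp: build_mat_def mat_of_rows_list_def)

lemma val_mat_add_op:
  "X \<in> carrier_mat n n \<Longrightarrow> Y \<in> carrier_mat n n \<Longrightarrow> val (mat_add_op n X Y) = X + Y"
  by (auto simp: mat_add_op_def)

lemma val_mat_sub_op:
  "X \<in> carrier_mat n n \<Longrightarrow> Y \<in> carrier_mat n n \<Longrightarrow> val (mat_sub_op n X Y) = X - Y"
  by (auto simp: mat_sub_op_def)

lemma val_id_mat_op: "val (id_mat_op n) = 1\<^sub>m n"
  by (auto simp: id_mat_op_def)

lemma val_diag_mult_op:
  assumes "X \<in> carrier_mat n n"
  shows "val (diag_mult_op n v X) = mat n n (\<lambda>(i, j). if i = j then v $ i else 0) * X"
proof -
  have "(\<Sum>k = 0..<n. (if i = k then v $ i else 0) * X $$ (k, j)) = v $ i * X $$ (i, j)"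
    if "i < n" for i j
  proof -
    have "(\<Sum>k = 0..<n. (if i = k then v $ i else 0) * X $$ (k, j)) =
        (\<Sum>k = 0..<n. if i = k then v $ i * X $$ (k, j) else 0)"
      by (intro sum.cong) auto
    then show ?thesis using that by simp
  qed
  then show ?thesis
    using assms by (intro eq_matI) (auto simp: diag_mult_op_def scalar_prod_def)
qed

lemma sum_list_filter_zero:
  fixes g :: "'a \<Rightarrow> real"
  assumes "\<And>a. \<not> P a \<Longrightarrow> g a = 0"
  shows "(\<Sum>a\<leftarrow>filter P as. g a) = (\<Sum>a\<leftarrow>as. g a)"
  using assms by (induction as) auto

lemma val_adj_mult_op_dense:
  assumes "A \<in> carrier_mat n n" "X \<in> carrier_mat n n"
  shows "val (adj_mult_op n (dense n A) X) = A * X"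
  using assms
  by (intro eq_matI)
    (auto simp: adj_mult_op_def dense_def comp_def scalar_prod_def interv_sum_list_conv_sum_set_nat
      intro!: sum.cong)

lemma val_adj_mult_op_sparse:
  "val (adj_mult_op n (sparse n A) X) = val (adj_mult_op n (dense n A) X)"
proof -
  have "(\<Sum>j\<leftarrow>filter (\<lambda>j. A $$ (i, j) \<noteq> 0) [0..<n]. A $$ (i, j) * X $$ (j, c)) =
      (\<Sum>j\<leftarrow>[0..<n]. A $$ (i, j) * X $$ (j, c))" for i c
    by (rule sum_list_filter_zero) auto
  then show ?thesis by (auto simp: adj_mult_op_def dense_def sparse_def comp_def)
qed

lemma val_argmin_row_op_dense:
  "val (argmin_row_op n (dense n A) i r k X) =
    vec n (\<lambda>c. \<Sum>j<n. (if r $ j = k \<and> A $$ (j, i) \<noteq> 0 then 1 else 0) * X $$ (j, c))"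
  by (auto simp: argmin_row_op_def dense_def comp_def interv_sum_list_conv_sum_set_nat
      atLeast0LessThan intro!: sum.cong)

lemma val_argmin_row_op_sparse:
  "val (argmin_row_op n (sparse n A) i r k X) = val (argmin_row_op n (dense n A) i r k X)"
proof -
  have "(\<Sum>j\<leftarrow>filter (\<lambda>j. A $$ (j, i) \<noteq> 0) [0..<n].
        (if r $ j = k \<and> A $$ (j, i) \<noteq> 0 then 1 else 0) * X $$ (j, c)) =
      (\<Sum>j\<leftarrow>[0..<n]. (if r $ j = k \<and> A $$ (j, i) \<noteq> 0 then 1 else 0) * X $$ (j, c))" for c
    by (rule sum_list_filter_zero) auto
  then show ?thesis by (auto simp: argmin_row_op_def dense_def sparse_def comp_def)
qed

lemma val_fold_loop:
  "val (fold_loop f as s) = fold (\<lambda>a s. val (f a s)) as s"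
  by (induction as arbitrary: s) auto

theorem val_ipa_sparse: "val (ipa_sparse x) = val (ipa_dense x)"
proof -
  have "val (ipa_step (sparse (items x) (bom x)) x t J) =
      val (ipa_step (dense (items x) (bom x)) x t J)" for t J
    by (simp add: ipa_step_def Let_def val_fold_loop val_adj_mult_op_sparse
        val_argmin_row_op_sparse case_prod_unfold if_distrib[where f = val] cong: if_cong)
  then show ?thesis by (simp add: ipa_sparse_def ipa_dense_def ipa_def val_fold_loop)
qed

end

theory Submission
  imports Defs
begin

text \<open>
  One period consists of a bounded number (depending only on the number of layers) of dense
  matrix operations, costing \<open>O(n\<^sup>2)\<close>, and of products with stored entries of \<open>A\<close>, costing
  \<open>O(n e)\<close> for \<open>e\<close> stored entries; hence the total is \<open>O(T n (n + e))\<close>.  Dense storage has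
  \<open>e = n\<^sup>2\<close> and sparse storage has \<open>e = m\<close>.  Since no item is isolated, \<open>n \<le> 2 m\<close>, so the dense
  operations are absorbed by \<open>n m \<le> \<rho> n\<^sup>3\<close>.
\<close>

section \<open>Costs of the elementary operations\<close>

lemma ops_map_loop: "ops (map_loop f as) = (\<Sum>a\<leftarrow>as. 1 + ops (f a))"
  by (induction as) auto

text \<open>\<open>g\<close> ignores the state \<open>s\<close>, so a loop is bounded without
  knowing the values it computes; the extra 1 is the assignment of the loop variable.\<close>

lemma ops_fold_loop_le:
  assumes "\<And>a s. ops (f a s) \<le> g a"
  shows "ops (fold_loop f as s) \<le> (\<Sum>a\<leftarrow>as. 1 + g a)"
proof (induction as arbitrary: s)
  case (Cons a as)
  then show ?case
    using add_mono[OF assms[of a s] Cons.IH[of "val (f a s)"]] by simp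
qed simp

lemma ops_bind_le:
  assumes "ops m \<le> a" "\<And>y. ops (f y) \<le> b"
  shows "ops (counted_bind m f) \<le> a + b"
  using add_mono[OF assms(1) assms(2)[of "val m"]] by simp

text \<open>Adding the branch bounds instead of taking their maximum keeps every bound a polynomial
  that \<open>simp\<close> can compare.\<close>

lemma ops_if_le:
  assumes "ops m \<le> a" "ops m' \<le> b"
  shows "ops (if P then m else m') \<le> a + b"
  using assms by auto

lemma ops_case_prod_le:
  assumes "\<And>a b. ops (f a b) \<le> c"
  shows "ops (case_prod f p) \<le> c"
  using assms by (cases p) auto

lemma ops_tick_le: "ops (tick a) \<le> 1"
  by simp

lemma ops_ret_le: "ops (ret a) \<le> 0"
  by simp

lemmas ops_control_le = ops_bind_le ops_if_le ops_case_prod_le ops_tick_le ops_ret_le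

lemma ops_sum_loop_le:
  assumes "\<And>a. ops (f a) \<le> c"
  shows "ops (sum_loop f as) \<le> length as * (2 + c)"
proof -
  have "ops (sum_loop f as) \<le> (\<Sum>a\<leftarrow>as. 1 + (c + 1))"
    unfolding sum_loop_def by (intro ops_fold_loop_le ops_control_le assms)
  then show ?thesis by (simp add: sum_list_triv)
qed

lemma ops_build_vec_le:
  assumes "\<And>i. ops (f i) \<le> c"
  shows "ops (build_vec n f) \<le> n * (2 + c)"
proof -
  have "ops (build_vec n f) = (\<Sum>i\<leftarrow>[0..<n]. 2 + ops (f i))"
    by (simp add: build_vec_def ops_map_loop)
  also have "\<dots> \<le> (\<Sum>i\<leftarrow>[0..<n]. 2 + c)"
    by (intro sum_list_mono add_left_mono assms)
  finally show ?thesis by (simp add: sum_list_triv)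
qed

text \<open>\<open>g\<close> varies with the row because in a product with \<open>A\<close> the cost
  of an entry depends on how many entries of that row of \<open>A\<close> are stored.\<close>

lemma ops_build_mat_le:
  assumes "\<And>i j. ops (f i j) \<le> g i"
  shows "ops (build_mat n f) \<le> (\<Sum>i<n. 1 + n * (2 + g i))"
proof -
  have "ops (build_mat n f) = (\<Sum>i\<leftarrow>[0..<n]. 1 + (\<Sum>j\<leftarrow>[0..<n]. 2 + ops (f i j)))"
    by (simp add: build_mat_def ops_map_loop)
  also have "\<dots> \<le> (\<Sum>i\<leftarrow>[0..<n]. 1 + (\<Sum>j\<leftarrow>[0..<n]. 2 + g i))"
    by (intro sum_list_mono add_left_mono assms)
  finally show ?thesis
    by (simp add: sum_list_triv interv_sum_list_conv_sum_set_nat atLeast0LessThan)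
qed

lemma ops_build_mat_le':
  assumes "\<And>i j. ops (f i j) \<le> c"
  shows "ops (build_mat n f) \<le> n + n * n * (2 + c)"
  using ops_build_mat_le[of f "\<lambda>_. c" n, OF assms] by (simp add: algebra_simps)

lemma ops_matrix_le:
  "ops (zero_mat_op n) \<le> n + n * n * 2"
  "ops (id_mat_op n) \<le> n + n * n * 3"
  "ops (mat_add_op n X Y) \<le> n + n * n * 3"
  "ops (mat_sub_op n X Y) \<le> n + n * n * 3"
  "ops (diag_mult_op n v X) \<le> n + n * n * 3"
  unfolding zero_mat_op_def id_mat_op_def mat_add_op_def mat_sub_op_def diag_mult_op_def
  \<comment> \<open>The middle term of \<open>order_trans\<close> stays schematic: the rules follow
    the program text and build it, then \<open>simp\<close> compares it with the stated
    bound.\<close>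
  by (-, (rule order_trans, (rule ops_build_mat_le' ops_control_le)+, simp)+)

lemma ops_vector_le:
  "ops (zero_vec_op n) \<le> n * 2"
  "ops (vec_add_op n u v) \<le> n * 3"
  "ops (vec_sub_op n u v) \<le> n * 3"
  "ops (write_row_op n i v X) \<le> n * 2"
  unfolding zero_vec_op_def vec_add_op_def vec_sub_op_def write_row_op_def
  by (-, (rule order_trans, (rule ops_build_vec_le ops_control_le)+, simp)+)

lemma ops_indicator_le:
  assumes "\<And>i. ops (P i) \<le> c"
  shows "ops (indicator_op n P) \<le> n * (2 + c)" "ops (neg_indicator_op n P) \<le> n * (2 + c)"
  unfolding indicator_op_def neg_indicator_op_def
  by (-, (rule order_trans, (rule ops_build_vec_le ops_bind_le ops_ret_le assms)+, simp)+)

lemma ops_vec_mat_le: "ops (vec_mat_op n v X) \<le> n * (2 + n * 3)"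
  unfolding vec_mat_op_def
  by (rule order_trans, (rule ops_build_vec_le ops_sum_loop_le ops_tick_le)+) simp

text \<open>Each of the \<open>n\<close> entries in row \<open>i\<close> of the product scans the
  stored entries of row \<open>i\<close> of \<open>A\<close>. Over all rows this makes at most
  \<open>n * e\<close> visits of 3 operations each: loop variable, product, addition.\<close>

lemma ops_adj_mult_le:
  assumes "(\<Sum>i<n. length (row_entries G i)) \<le> e"
  shows "ops (adj_mult_op n G X) \<le> n + n * n * 2 + n * e * 3"
proof -
  have "ops (adj_mult_op n G X) \<le> (\<Sum>i<n. 1 + n * (2 + length (row_entries G i) * (2 + 1)))"
    unfolding adj_mult_op_def
    by (intro ops_build_mat_le ops_sum_loop_le ops_control_le)
  also have "\<dots> = n + n * n * 2 + n * (\<Sum>i<n. length (row_entries G i)) * 3"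
    by (simp add: sum.distrib sum_Suc distrib_left flip: sum_distrib_left sum_distrib_right)
  finally show ?thesis using assms by (meson add_left_mono mult_le_mono le_refl order_trans)
qed

lemma ops_argmin_row_le:
  "ops (argmin_row_op n G i r k X) \<le>
     length (col_entries G i) * 4 + n * (2 + length (col_entries G i) * 3)"
proof -
  define w where "w = map_loop (\<lambda>(j, a). counted_bind (tick (r $ j = k)) (\<lambda>b.
      counted_bind (tick (a \<noteq> (0::real))) (\<lambda>c.
      counted_bind (tick (if b \<and> c then 1 else 0 :: real)) (\<lambda>u. ret (j, u))))) (col_entries G i)"
  have w: "ops w = length (col_entries G i) * 4" "length (val w) = length (col_entries G i)"
    by (simp_all add: w_def ops_map_loop case_prod_unfold sum_list_triv)
  have "ops (build_vec n (\<lambda>c. sum_loop (\<lambda>(j, u). tick (u * X $$ (j, c))) (val w)))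
      \<le> n * (2 + length (val w) * (2 + 1))"
    by (intro ops_build_vec_le ops_sum_loop_le ops_control_le)
  then show ?thesis
    by (simp add: argmin_row_op_def w flip: w_def)
qed


section \<open>Cost of the gradient procedure\<close>

lemma ops_ipa_step_le:
  fixes x G
  defines "n \<equiv> items x"
  assumes "0 < n" "layers x \<le> L"
    and rows: "(\<Sum>i<n. length (row_entries G i)) \<le> e"
    and cols: "(\<Sum>i<n. length (col_entries G i)) \<le> e"
  shows "ops (ipa_step G x t J) \<le> (138 + 22 * L) * (n * (n + e))"
proof -
  note bounds = ops_control_le ops_matrix_le ops_vector_le ops_indicator_le ops_vec_mat_le
    ops_adj_mult_le[OF rows] ops_argmin_row_le ops_build_vec_le ops_fold_loop_le
  define c where "c = (\<Sum>i<n. length (col_entries G i))"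
  \<comment> \<open>The coefficient 9 comes from three products with \<open>A\<close> outside the
    layer loop, the factor \<open>layers x - 1\<close> counts its rounds, and \<open>c\<close> the
    column entries scanned by \<open>argmin_row_op\<close> over all items.\<close>
  have "ops (ipa_step G x t J) \<le> 62 * n + 76 * (n * n) + 9 * (n * e)
      + (layers x - 1) * (1 + (10 * n + 11 * (n * n) + 3 * (n * e))) + (4 * c + 3 * (n * c))"
    unfolding ipa_step_def Let_def
    unfolding n_def[symmetric]
    apply (rule order_trans)
     apply (rule bounds)+
    apply (simp add: sum_list_triv interv_sum_list_conv_sum_set_nat atLeast0LessThan sum.distrib
        sum_Suc distrib_left c_def ac_simps flip: sum_distrib_left sum_distrib_right)
    done
  \<comment> \<open>Since \<open>1 \<le> n\<close>, constant and linear terms are absorbed into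
    \<open>n * n\<close>: 62 + 76 = 138 once, and 1 + 10 + 11 = 22 per layer.\<close>
  also have "\<dots> \<le> 62 * (n * n) + 76 * (n * n) + 9 * (n * e)
      + L * (n * n + (10 * (n * n) + 11 * (n * n) + 3 * (n * e))) + (4 * (n * e) + 3 * (n * e))"
  proof -
    have "c \<le> n * e"
      using mult_le_mono[of 1 n c e] cols \<open>0 < n\<close> by (simp add: c_def)
    then show ?thesis
      using \<open>0 < n\<close> \<open>layers x \<le> L\<close> cols
      by (intro add_mono mult_le_mono order_refl) (auto simp: c_def Suc_le_eq)
  qed
  also have "\<dots> \<le> (138 + 22 * L) * (n * (n + e))"
    by (simp add: algebra_simps)
  finally show ?thesis .
qed

text \<open>The pipeline holds one zero matrix for each period, which brings in the factor
  \<open>periods x\<close>.\<close>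

lemma ops_ipa_init_le:
  assumes "0 < items x" "0 < periods x"
  shows "ops (ipa_init x) \<le> 21 * (periods x * (items x * items x))"
proof -
  let ?n = "items x" and ?T = "periods x"
  have "ops (ipa_init x) \<le> 7 * ?n + 10 * (?n * ?n) + ?T * (1 + (?n + 2 * (?n * ?n)))"
    unfolding ipa_init_def Let_def
    apply (rule order_trans)
     apply (rule ops_control_le ops_matrix_le ops_vector_le ops_fold_loop_le)+
    apply (simp add: sum_list_triv algebra_simps)
    done
  also have "\<dots> \<le> 17 * (?n * ?n) + ?T * (4 * (?n * ?n))"
    using assms(1) by (intro add_mono mult_le_mono2) (auto simp: Suc_le_eq le_square)
  also have "\<dots> \<le> 21 * (?T * (?n * ?n))"
    using assms(2) by simp
  finally show ?thesis .
qed

lemma ops_ipa_le: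
  fixes x G
  defines "n \<equiv> items x"
  assumes "0 < n" "0 < periods x" "layers x \<le> L"
    and "(\<Sum>i<n. length (row_entries G i)) \<le> e"
    and "(\<Sum>i<n. length (col_entries G i)) \<le> e"
  shows "ops (ipa G x) \<le> (160 + 22 * L) * (periods x * (n * (n + e)))"
proof -
  let ?T = "periods x" and ?Q = "n * (n + e)"
  have "ops (ipa G x) \<le> 21 * (?T * (n * n)) + ?T * (1 + (138 + 22 * L) * ?Q)"
    unfolding ipa_def
    apply (rule order_trans)
     apply (rule ops_control_le ops_ipa_init_le ops_fold_loop_le ops_ipa_step_le
        assms[unfolded n_def])+
    apply (simp add: sum_list_triv n_def)
    done
  \<comment> \<open>Initialisation gives 21, the loop variable 1 and each period
    \<open>138 + 22 * L\<close>, in total \<open>160 + 22 * L\<close>.\<close>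
  also have "\<dots> \<le> 21 * (?T * ?Q) + ?T * (?Q + (138 + 22 * L) * ?Q)"
    using \<open>0 < n\<close> by (intro add_mono mult_le_mono order_refl) (auto simp: Suc_le_eq)
  also have "\<dots> = (160 + 22 * L) * (?T * ?Q)"
    by (simp add: algebra_simps)
  finally show ?thesis .
qed


section \<open>Storage sizes\<close>

lemma length_filter_upt: "length (filter P [0..<n]) = (\<Sum>j<n. if P j then 1 else 0)"
  by (induction n) auto

text \<open>Nonnegativity of the entries reconciles arcs, defined by positivity, with sparse
  storage, defined by being nonzero.\<close>

lemma arcs_iff_nonzero:
  assumes "inventory_system x"
  shows "(i, j) \<in> arcs x \<longleftrightarrow> i < items x \<and> j < items x \<and> bom x $$ (i, j) \<noteq> 0"
  using assms by (force simp: arcs_def inventory_system_def)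

lemma card_arcs:
  assumes "inventory_system x"
  shows "card (arcs x) = (\<Sum>i<items x. \<Sum>j<items x. if bom x $$ (i, j) \<noteq> 0 then 1 else 0)"
proof -
  have "arcs x = Sigma {..<items x} (\<lambda>i. {j \<in> {..<items x}. bom x $$ (i, j) \<noteq> 0})"
    using arcs_iff_nonzero[OF assms] by auto
  then show ?thesis by (simp add: sum.If_cases Int_def)
qed

lemma sparse_size:
  assumes "inventory_system x"
  defines "n \<equiv> items x"
  shows "(\<Sum>i<n. length (row_entries (sparse n (bom x)) i)) = card (arcs x)"
    and "(\<Sum>i<n. length (col_entries (sparse n (bom x)) i)) = card (arcs x)"
  \<comment> \<open>Counting by columns agrees with counting by rows after exchanging the two
    sums.\<close>
  unfolding card_arcs[OF assms(1)] n_def[symmetric]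
  by (simp_all add: sparse_def length_filter_upt)
    (subst sum.swap, rule refl)

lemma finite_arcs: "finite (arcs x)"
  by (rule finite_subset[of _ "{..<items x} \<times> {..<items x}"]) (auto simp: arcs_def)

text \<open>Each raw item starts an arc, each production item ends one, and an arc has only two
  endpoints.\<close>

lemma items_le_arcs:
  assumes "inventory_system x"
  shows "items x \<le> 2 * card (arcs x)"
proof -
  have "{..<items x} \<subseteq> fst ` arcs x \<union> snd ` arcs x"
  proof
    fix i assume "i \<in> {..<items x}"
    then have "\<exists>j. (i, j) \<in> arcs x \<or> (j, i) \<in> arcs x"
      using assms by (cases "i \<in> raw x") (auto simp: inventory_system_def)
    then show "i \<in> fst ` arcs x \<union> snd ` arcs x" by force
  qed
  then have "items x \<le> card (fst ` arcs x \<union> snd ` arcs x)"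
    using card_mono[of "fst ` arcs x \<union> snd ` arcs x" "{..<items x}"] by (simp add: finite_arcs)
  also have "\<dots> \<le> card (arcs x) + card (arcs x)"
    by (rule order_trans[OF card_Un_le add_mono]) (simp_all add: card_image_le finite_arcs)
  finally show ?thesis by simp
qed

text \<open>Some arc exists, and acyclicity makes its endpoints distinct. This keeps the denominator
  \<open>n * (n - 1)\<close> of the density away from 0.\<close>

lemma items_ge_2:
  assumes "inventory_system x"
  shows "2 \<le> items x"
proof -
  have "card (arcs x) \<noteq> 0"
    using items_le_arcs[OF assms] assms by (auto simp: inventory_system_def)
  then obtain i j where ij: "(i, j) \<in> arcs x"
    by (metis card.empty ex_in_conv surj_pair)
  moreover have "i \<noteq> j"
    using assms ij by (auto simp: inventory_system_def acyclic_def)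
  ultimately show ?thesis by (auto simp: arcs_def)
qed

lemma card_arcs_le_density:
  assumes "inventory_system x"
  shows "real (card (arcs x)) \<le> density x * real (items x) ^ 2"
proof -
  let ?n = "real (items x)"
  have n: "2 \<le> ?n" using items_ge_2[OF assms] by simp
  then have "real (card (arcs x)) = density x * (?n * (?n - 1))"
    by (simp add: density_def)
  also have "\<dots> \<le> density x * ?n ^ 2"
    using n by (intro mult_left_mono) (auto simp: density_def power2_eq_square)
  finally show ?thesis .
qed

section \<open>Explicit bounds for dense and sparse storage, and their asymptotic form\<close>

lemma ops_ipa_dense_le:
  assumes "x \<in> systems L"
  shows "real (ops (ipa_dense x)) \<le> 2 * (160 + 22 * real L) * (real (periods x) * real (items x) ^ 3)"
proof -
  let ?n = "items x"
  have "ops (ipa_dense x) \<le> (160 + 22 * L) * (periods x * (?n * (?n + ?n * ?n)))"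
    unfolding ipa_dense_def using assms
    by (intro ops_ipa_le) (auto simp: systems_def inventory_system_def dense_def)
  also have "\<dots> \<le> (160 + 22 * L) * (periods x * (?n * (2 * (?n * ?n))))"
    by (intro mult_le_mono order_refl) (simp add: le_square)
  also have "\<dots> = 2 * (160 + 22 * L) * (periods x * ?n ^ 3)"
    by (simp add: power3_eq_cube)
  finally show ?thesis by (simp flip: of_nat_le_iff[where 'a = real])
qed

lemma ops_ipa_sparse_le:
  assumes "x \<in> systems L"
  shows "real (ops (ipa_sparse x))
    \<le> 3 * (160 + 22 * real L) * (real (periods x) * density x * real (items x) ^ 3)"
proof -
  let ?n = "items x" and ?m = "card (arcs x)" and ?K = "160 + 22 * L"
  have x: "inventory_system x" and L: "layers x \<le> L"
    using assms by (auto simp: systems_def)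
  have "ops (ipa_sparse x) \<le> ?K * (periods x * (?n * (?n + ?m)))"
    unfolding ipa_sparse_def using x L
    by (intro ops_ipa_le) (auto simp: sparse_size inventory_system_def)
  \<comment> \<open>\<open>n \<le> 2 * m\<close> turns \<open>n + m\<close> into
    \<open>3 * m\<close>, so the dense operations cost no more than a multiple of the sparse
    products.\<close>
  also have "\<dots> \<le> ?K * (periods x * (?n * (3 * ?m)))"
    using items_le_arcs[OF x] by (intro mult_le_mono order_refl) simp
  finally have "real (ops (ipa_sparse x)) \<le> real (?K * (periods x * (?n * (3 * ?m))))"
    by (rule of_nat_mono)
  also have "\<dots> = real ?K * (real (periods x) * (real ?n * (3 * real ?m)))"
    by simp
  also have "\<dots> \<le> real ?K * (real (periods x) * (real ?n * (3 * (density x * real ?n ^ 2))))"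
    using card_arcs_le_density[OF x] by (intro mult_left_mono) auto
  finally show ?thesis by (simp add: power3_eq_cube power2_eq_square ac_simps)
qed

theorem theorem2:
  fixes L :: nat
  shows "(\<lambda>x. real (ops (ipa_dense x)))
           \<in> O[principal (systems L)](\<lambda>x. real (periods x) * real (items x) ^ 3) \<and>
         (\<lambda>x. real (ops (ipa_sparse x)))
           \<in> O[principal (systems L)](\<lambda>x. real (periods x) * density x * real (items x) ^ 3) \<and>
         (\<forall>c :: real. (\<lambda>x. real (ops (ipa_sparse x)))
           \<in> O[principal {x \<in> systems L. real (items x) * density x \<le> c}](\<lambda>x.
                real (periods x) * real (items x) ^ 2))"
proof (intro conjI allI)
  let ?K = "160 + 22 * real L"
  show "(\<lambda>x. real (ops (ipa_dense x)))
      \<in> O[principal (systems L)](\<lambda>x. real (periods x) * real (items x) ^ 3)"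
    \<comment> \<open>On a principal filter "eventually" means for every member, so the pointwise
      bound supplies the constant directly.\<close>
    by (rule bigoI[where c = "2 * ?K"])
      (use ops_ipa_dense_le in \<open>auto simp: eventually_principal abs_mult\<close>)
  \<comment> \<open>Landau bounds compare absolute values, so the sign of the density
    matters.\<close>
  have density_nonneg: "0 \<le> density x" if "x \<in> systems L" for x
    using items_ge_2[of x] that by (auto simp: systems_def density_def)
  show "(\<lambda>x. real (ops (ipa_sparse x)))
      \<in> O[principal (systems L)](\<lambda>x. real (periods x) * density x * real (items x) ^ 3)"
    by (rule bigoI[where c = "3 * ?K"])
      (use ops_ipa_sparse_le density_nonneg in \<open>auto simp: eventually_principal abs_mult\<close>)
  fix c :: real
  have "real (ops (ipa_sparse x)) \<le> 3 * ?K * c * (real (periods x) * real (items x) ^ 2)"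
    if "x \<in> systems L" and c: "real (items x) * density x \<le> c" for x
  proof -
    \<comment> \<open>One factor \<open>n * density x\<close> is split off
      \<open>density x * n ^ 3\<close> and bounded by \<open>c\<close>.\<close>
    have "real (ops (ipa_sparse x))
        \<le> (3 * ?K * real (periods x) * real (items x) ^ 2) * (real (items x) * density x)"
      using ops_ipa_sparse_le[OF that(1)] by (simp add: power3_eq_cube power2_eq_square ac_simps)
    also have "\<dots> \<le> (3 * ?K * real (periods x) * real (items x) ^ 2) * c"
      using c by (intro mult_left_mono) auto
    finally show ?thesis by (simp add: ac_simps)
  qed
  then show "(\<lambda>x. real (ops (ipa_sparse x)))
      \<in> O[principal {x \<in> systems L. real (items x) * density x \<le> c}](\<lambda>x.
           real (periods x) * real (items x) ^ 2)"
    by (intro bigoI[where c = "3 * ?K * c"]) (auto simp: eventually_principal abs_mult)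
qed

end
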